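(* Consider a relaxation method based on a time integration method of order $p\ge 2$ for the ODE $u'(t)=f(u(t))$. If $\eta$ is a convex entropy for the ODE, $\Delta t$ is sufficiently small, and $$\eta''(u^{\mathrm{old}})\bigl(f(u^{\mathrm{old}}),f(u^{\mathrm{old}})\bigr)\neq 0,$$ then there is a unique $\gamma>0$ that satisfies the relaxation condition $$\eta\bigl(u^{\mathrm{old}}+\gamma(u^{\mathrm{new}}-u^{\mathrm{old}})\bigr)=\eta^{\mathrm{old}}+\gamma(\eta^{\mathrm{new}}-\eta^{\mathrm{old}}),$$ and the resulting relaxation method is of order $p$, i.e. $u^n_\gamma=u(t^n_\gamma)+\mathcal{O}(\Delta t^{p+1})$.
   Context: Setting. $u'(t)=f(u(t))$ is an ODE in a Banach space with smooth $f$, and $u$ is a (smooth) solution. All $\mathcal{O}(\cdot)$ refer to the limit $\Delta t\to 0$; inside $\mathcal{O}(\cdot)$, superscripts of $\Delta t$ are exponents, whereas superscripts of $t$ and $u$ are time step indices. Baseline method. A $k$-step time integration method computes $u^{\mathrm{new}}=\psi(f,\Delta t,u^{n-1},\dots,u^{n-k})$ as an approximation at time $t^{\mathrm{new}}=t^{n-1}+\Delta t$. Order is understood in the local sense: for previous values with $u^{n-j}=u(t^{n-j})+\mathcal{O}(\Delta t^{p+1})$ at previous times $t^{n-j}$ (increasing in the index, with spacings $\mathcal{O}(\Delta t)$), one has $u^{\mathrm{new}}=u(t^{\mathrm{new}})+\mathcal{O}(\Delta t^{p+1})$. Old values. Fix $m\ge1$ and weights $\nu_0,\dots,\nu_{m-1}\ge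 0$ with $\sum_i\nu_i=1$, and set $t^{\mathrm{old}}=\sum_{i=0}^{m-1}\nu_i t^{n-m+i}$, $u^{\mathrm{old}}=\sum_{i=0}^{m-1}\nu_i u^{n-m+i}$, $\eta^{\mathrm{old}}=\sum_{i=0}^{m-1}\nu_i\,\eta(u^{n-m+i})$. Estimate. $\eta^{\mathrm{new}}$ is a given number with $\eta^{\mathrm{new}}=\eta(u^{\mathrm{new}})+\mathcal{O}(\Delta t^{p+1})$ (for invariants one takes $\eta^{\mathrm{new}}=\eta^{\mathrm{old}}$). Relaxation method. $u^n_\gamma=u^{\mathrm{old}}+\gamma(u^{\mathrm{new}}-u^{\mathrm{old}})$ and $t^n_\gamma=t^{\mathrm{old}}+\gamma(t^{\mathrm{new}}-t^{\mathrm{old}})$, with $\gamma$ chosen to satisfy the relaxation condition; the integration is continued with $(t^n_\gamma,u^n_\gamma)$ in place of $(t^{\mathrm{new}},u^{\mathrm{new}})$. A convex entropy is a smooth convex real-valued functional $\eta$ on the state space whose evolution along solutions is to be reproduced (it may be conserved, dissipated, or neither). The non-degeneracy condition is understood to hold with a constant independent of $\Delta t$, i.e. the (nonnegative) quantity stays bounded away from $0$ as $\Delta t\to 0$. *)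

theory Defs
  imports "HOL-Analysis.Analysis" "HOL-Library.Landau_Symbols"
begin

text \<open>
  \<^bold>\<open>Smoothness.\<close>  The \<open>n\<close>-th Frechet derivative lives in the space of bounded \<open>n\<close>-linear maps, a
  type depending on \<open>n\<close>.  Such maps are therefore represented as functions on argument lists of
  length \<open>n\<close>; their values on lists of any other length are irrelevant.
\<close>

definition bounded_multilinear ::
  "nat \<Rightarrow> ('a::real_normed_vector list \<Rightarrow> 'b::real_normed_vector) \<Rightarrow> bool" where
  "bounded_multilinear n M \<longleftrightarrow>
     (\<forall>vs i. length vs = n \<longrightarrow> i < n \<longrightarrow> linear (\<lambda>v. M (vs[i := v]))) \<and>
     (\<exists>B. \<forall>vs. length vs = n \<longrightarrow> norm (M vs) \<le> B * prod_list (map norm vs))"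

text \<open>
  \<open>D n x\<close> is the \<open>n\<close>-th derivative at \<open>x\<close>, the direction of the latest differentiation coming
  first.  The last clause says that \<open>D n\<close> is Frechet differentiable at \<open>x\<close> with derivative
  \<open>D (Suc n) x\<close>, with respect to the operator norm on bounded \<open>n\<close>-linear maps.  To be used for
  open \<open>S\<close>.
\<close>

definition smooth_on ::
  "'a::real_normed_vector set \<Rightarrow> ('a \<Rightarrow> 'b::real_normed_vector) \<Rightarrow> bool" where
  "smooth_on S g \<longleftrightarrow>
     (\<exists>D :: nat \<Rightarrow> 'a \<Rightarrow> 'a list \<Rightarrow> 'b.
        (\<forall>x\<in>S. D 0 x [] = g x) \<and>
        (\<forall>n. \<forall>x\<in>S. bounded_multilinear n (D n x)) \<and>
        (\<forall>n. \<forall>x\<in>S. \<forall>\<epsilon>>0. \<forall>\<^sub>F y in at x. \<forall>vs. length vs = n \<longrightarrow>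
            norm (D n y vs - D n x vs - D (Suc n) x ((y - x) # vs))
              \<le> \<epsilon> * norm (y - x) * prod_list (map norm vs)))"

text \<open>The second derivative \<open>g''(x)(v, w)\<close>.\<close>

definition second_derivative ::
  "('a::real_normed_vector \<Rightarrow> 'b::real_normed_vector) \<Rightarrow> 'a \<Rightarrow> 'a \<Rightarrow> 'a \<Rightarrow> 'b" where
  "second_derivative g x v w =
     frechet_derivative (\<lambda>y. frechet_derivative g (at y) w) (at x) v"

definition convex_entropy :: "('a::real_normed_vector \<Rightarrow> real) \<Rightarrow> bool" where
  "convex_entropy \<eta> \<longleftrightarrow> smooth_on UNIV \<eta> \<and> convex_on UNIV \<eta>"

definition ode_solution_on ::
  "real set \<Rightarrow> ('a::real_normed_vector \<Rightarrow> 'a) \<Rightarrow> (real \<Rightarrow> 'a) \<Rightarrow> bool" where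
  "ode_solution_on I f u \<longleftrightarrow>
     open I \<and> is_interval I \<and> smooth_on I u \<and>
     (\<forall>t\<in>I. (u has_vector_derivative f (u t)) (at t))"

text \<open>
  \<^bold>\<open>Time steps.\<close>  All data of a step depend on the step size \<open>h\<close>, and Landau symbols refer to
  \<open>h \<rightarrow> 0+\<close>.  Backward indexing is used: \<open>\<tau> h j\<close> and \<open>v h j\<close> (\<open>j \<ge> 1\<close>) stand for the previous time
  \<open>t^(n-j)\<close> and the previous value \<open>u^(n-j)\<close>.  The last time \<open>t^(n-1)\<close> may depend on \<open>h\<close>, but
  stays in a compact part of the domain \<open>I\<close> of the solution; then all the other times eventually
  lie in \<open>I\<close>, too.
\<close>

definition previous_times :: "nat \<Rightarrow> real set \<Rightarrow> (real \<Rightarrow> nat \<Rightarrow> real) \<Rightarrow> bool" where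
  "previous_times N I \<tau> \<longleftrightarrow>
     (\<exists>K. compact K \<and> K \<subseteq> I \<and> (\<forall>\<^sub>F h in at_right 0. \<tau> h 1 \<in> K)) \<and>
     (\<forall>\<^sub>F h in at_right 0. \<forall>j\<in>{1..<N}. \<tau> h (Suc j) < \<tau> h j) \<and>
     (\<forall>j\<in>{1..<N}. (\<lambda>h. \<tau> h j - \<tau> h (Suc j)) \<in> O[at_right 0](\<lambda>h. h))"

definition previous_values ::
  "nat \<Rightarrow> nat \<Rightarrow> (real \<Rightarrow> 'a::real_normed_vector) \<Rightarrow> (real \<Rightarrow> nat \<Rightarrow> real) \<Rightarrow> (real \<Rightarrow> nat \<Rightarrow> 'a) \<Rightarrow> bool"
  where
  "previous_values N p u \<tau> v \<longleftrightarrow>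
     (\<forall>j\<in>{1..N}. (\<lambda>h. norm (v h j - u (\<tau> h j))) \<in> O[at_right 0](\<lambda>h. h ^ (p + 1)))"

text \<open>
  A time integration method maps the right-hand side, the step size, the list of the previous
  times and the list of the previous values \<open>[u^(n-1), \<dots>, u^(n-k)]\<close> to the new value.  The times
  are an argument because the coefficients of a multistep method depend on the preceding step
  sizes when these vary, as they do under relaxation; a method is free to ignore them.
\<close>

type_synonym 'a integrator =
  "('a \<Rightarrow> 'a) \<Rightarrow> real \<Rightarrow> real list \<Rightarrow> 'a list \<Rightarrow> 'a"

definition new_value ::
  "nat \<Rightarrow> 'a integrator \<Rightarrow> ('a \<Rightarrow> 'a) \<Rightarrow> (real \<Rightarrow> nat \<Rightarrow> real) \<Rightarrow> (real \<Rightarrow> nat \<Rightarrow> 'a) \<Rightarrow> real \<Rightarrow> 'a" where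
  "new_value k \<psi> f \<tau> v h = \<psi> f h (map (\<tau> h) [1..<Suc k]) (map (v h) [1..<Suc k])"

text \<open>
  Order \<open>p\<close> (in the local sense) of a \<open>k\<close>-step method for \<open>u' = f(u)\<close>.  The parameter \<open>G\<close> is the
  class of time grids on which the method is considered: \<open>G = UNIV\<close> imposes no restriction, but
  typical multistep methods attain their order only on, say, equidistant grids or grids with
  bounded step size ratios.
\<close>

definition method_of_order ::
  "nat \<Rightarrow> nat \<Rightarrow> (real \<Rightarrow> nat \<Rightarrow> real) set \<Rightarrow> ('a::real_normed_vector) integrator \<Rightarrow> ('a \<Rightarrow> 'a) \<Rightarrow> bool"
  where
  "method_of_order k p G \<psi> f \<longleftrightarrow>
     (\<forall>I u \<tau> v. ode_solution_on I f u \<longrightarrow> \<tau> \<in> G \<longrightarrow> previous_times k I \<tau> \<longrightarrow>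
        previous_values k p u \<tau> v \<longrightarrow>
        (\<lambda>h. norm (new_value k \<psi> f \<tau> v h - u (\<tau> h 1 + h))) \<in> O[at_right 0](\<lambda>h. h ^ (p + 1)))"

text \<open>
  The average \<open>\<Sum>i<m. \<nu>\<^sub>i x^(n-m+i)\<close> over the last \<open>m\<close> steps, where \<open>x j\<close> is the quantity at step
  \<open>n - j\<close>.
\<close>

definition old_average ::
  "nat \<Rightarrow> (nat \<Rightarrow> real) \<Rightarrow> (nat \<Rightarrow> 'a::real_vector) \<Rightarrow> 'a" where
  "old_average m \<nu> x = (\<Sum>i<m. \<nu> i *\<^sub>R x (m - i))"

end

theory Submission
  imports Defs
begin

text \<open>
  Put \<open>d = u_new - u_old\<close> and
  \<open>r(\<gamma>) = \<eta>(u_old + \<gamma> d) - \<eta>_old - \<gamma> (\<eta>_new - \<eta>_old)\<close>, a convex function of \<open>\<gamma>\<close>.  Jensen's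
  inequality gives \<open>r(0) \<le> 0\<close>, and \<open>r(1) = \<eta>(u_new) - \<eta>_new = O(h^(p+1))\<close>.  Since \<open>d\<close> is to leading
  order a multiple \<open>H \<ge> h\<close> of \<open>f(u_old)\<close> and \<open>\<eta>''\<close> is uniformly continuous near the compact piece
  of the solution curve, non-degeneracy gives \<open>r'' \<ge> \<mu>\<close> on \<open>[0, 2]\<close> with \<open>\<mu> = c h\<^sup>2 / 2\<close>.  Strong
  convexity alone then forces \<open>r(1/2) < 0 \<le> r(3/2)\<close>, excludes a second positive root, and bounds the
  distance of the root from \<open>1\<close> by \<open>2 \<bar>r(1)\<bar> / \<mu> = O(h^(p-1))\<close>.

  Finally, \<open>d - H u'\<close> is \<open>O(h\<^sup>2)\<close>, so moving from \<open>\<gamma> = 1\<close> to the root changes the error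
  \<open>u_new - u(t_new)\<close> by \<open>O(h^(p-1)) O(h\<^sup>2) = O(h^(p+1))\<close> only.
\<close>

lemma bounded_multilinear_Cons:
  assumes "bounded_multilinear (Suc n) M" "length vs = n"
  shows "bounded_linear (\<lambda>v. M (v # vs))"
proof -
  \<comment> \<open>Multilinearity is stated through list updates. The head \<open>undefined\<close>
    is a placeholder that the update at position 0 overwrites.\<close>
  have "linear (\<lambda>v. M ((undefined # vs)[0 := v]))"
    using assms unfolding bounded_multilinear_def by (metis length_Cons zero_less_Suc)
  then have lin: "linear (\<lambda>v. M (v # vs))"
    by simp
  obtain B where B: "\<And>ws. length ws = Suc n \<Longrightarrow> norm (M ws) \<le> B * prod_list (map norm ws)"
    using assms unfolding bounded_multilinear_def by blast
  show ?thesis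
  proof (rule bounded_linear_intro)
    show "norm (M (v # vs)) \<le> norm v * (B * prod_list (map norm vs))" for v
      using B[of "v # vs"] assms(2) by (simp add: mult_ac)
  qed (use linear_add[OF lin] linear_scale[OF lin] in auto)
qed

lemma bounded_multilinear_2:
  assumes "bounded_multilinear 2 M"
  shows "bounded_bilinear (\<lambda>v w. M [v, w])"
proof -
  have "linear (\<lambda>v. M ([v', w][0 := v]))" "linear (\<lambda>w. M ([v', w'][1 := w]))" for v' w w'
    using assms unfolding bounded_multilinear_def by (auto simp del: list_update.simps)
  then have lin: "linear (\<lambda>v. M [v, w])" "linear (\<lambda>w. M [v, w])" for v w
    by simp_all
  obtain B where B: "\<And>ws. length ws = 2 \<Longrightarrow> norm (M ws) \<le> B * prod_list (map norm ws)"
    using assms unfolding bounded_multilinear_def by blast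
  have "norm (M [v, w]) \<le> norm v * norm w * B" for v w
    using B[of "[v, w]"] by (simp add: mult_ac)
  then show ?thesis
    by unfold_locales (use lin[THEN linear_add] lin[THEN linear_scale] in auto)
qed

text \<open>The derivative hierarchy behind \<open>smooth_on\<close> is cut down to what the later
  estimates use: two derivatives, and continuity of the quadratic form \<open>g2 x w w\<close>
  jointly in the base point and the direction. The continuity comes from the third derivative, which
  controls the change of the second one in operator norm.\<close>

lemma smooth_on_C2:
  fixes g :: "'a::real_normed_vector \<Rightarrow> 'b::real_normed_vector"
  assumes "smooth_on S g" "open S"
  obtains g1 g2 where
    "\<And>x. x \<in> S \<Longrightarrow> (g has_derivative g1 x) (at x)"
    "\<And>x w. x \<in> S \<Longrightarrow> ((\<lambda>y. g1 y w) has_derivative (\<lambda>v. g2 x v w)) (at x)"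
    "\<And>x. x \<in> S \<Longrightarrow> bounded_bilinear (g2 x)"
    "\<And>x w. x \<in> S \<Longrightarrow> isCont (\<lambda>z. g2 (fst z) (snd z) (snd z)) (x, w)"
proof -
  obtain D :: "nat \<Rightarrow> 'a \<Rightarrow> 'a list \<Rightarrow> 'b" where
    D0: "\<And>x. x \<in> S \<Longrightarrow> D 0 x [] = g x" and
    ml: "\<And>n x. x \<in> S \<Longrightarrow> bounded_multilinear n (D n x)" and
    D: "\<And>n x \<epsilon>. x \<in> S \<Longrightarrow> \<epsilon> > 0 \<Longrightarrow> \<forall>\<^sub>F y in at x. \<forall>vs. length vs = n \<longrightarrow>
            norm (D n y vs - D n x vs - D (Suc n) x ((y - x) # vs))
              \<le> \<epsilon> * norm (y - x) * prod_list (map norm vs)"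
    using assms(1) unfolding smooth_on_def by blast
  have der: "((\<lambda>y. D n y vs) has_derivative (\<lambda>v. D (Suc n) x (v # vs))) (at x)"
    if x: "x \<in> S" and n: "length vs = n" for n x vs
    unfolding has_derivative_within_alt2
  proof (intro conjI allI impI)
    show "bounded_linear (\<lambda>v. D (Suc n) x (v # vs))"
      using ml[OF x] n by (rule bounded_multilinear_Cons)
    fix e :: real assume "e > 0"
    define P where "P = prod_list (map norm vs)"
    have "P \<ge> 0" unfolding P_def by (rule prod_list_nonneg) auto
    \<comment> \<open>The operator norm estimate is specialised to the fixed list \<open>vs\<close>;
      the summand 1 covers the case that \<open>P\<close> vanishes.\<close>
    define \<epsilon> where "\<epsilon> = e / (P + 1)"
    have \<epsilon>: "\<epsilon> > 0" "\<epsilon> * P \<le> e"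
      using \<open>e > 0\<close> \<open>P \<ge> 0\<close> by (auto simp: \<epsilon>_def field_simps)
    show "\<forall>\<^sub>F y in at x. norm (D n y vs - D n x vs - D (Suc n) x ((y - x) # vs)) \<le> e * norm (y - x)"
      using D[OF x \<epsilon>(1), of n]
    proof eventually_elim
      case (elim y)
      then have "norm (D n y vs - D n x vs - D (Suc n) x ((y - x) # vs)) \<le> \<epsilon> * norm (y - x) * P"
        using n by (auto simp: P_def)
      also have "\<dots> = (\<epsilon> * P) * norm (y - x)" by simp
      also have "\<dots> \<le> e * norm (y - x)" using \<epsilon>(2) by (rule mult_right_mono) auto
      finally show ?case .
    qed
  qed
  show thesis
  proof
    fix x assume x: "x \<in> S"
    show "(g has_derivative (\<lambda>v. D 1 x [v])) (at x)"
      \<comment> \<open>\<open>D 0 y []\<close> is known to equal \<open>g y\<close> only for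
        \<open>y\<close> in \<open>S\<close>, so the derivative is transferred on this open
        set.\<close>
      by (rule has_derivative_transform_within_open[OF _ \<open>open S\<close> x D0])
         (use der[OF x, of "[]" 0] in auto)
    show "((\<lambda>y. D 1 y [w]) has_derivative (\<lambda>v. D 2 x [v, w])) (at x)" for w
      using der[OF x, of "[w]" 1] by (simp add: numeral_2_eq_2)
    show bil: "bounded_bilinear (\<lambda>v w. D 2 x [v, w])"
      using ml[OF x] by (rule bounded_multilinear_2)
    show "isCont (\<lambda>z. D 2 (fst z) [snd z, snd z]) (x, w)" for w
    proof -
      let ?F = "at (x, w)"
      interpret bounded_bilinear "\<lambda>a b. D 2 x [a, b]" by fact
      obtain B where B: "\<And>vs. length vs = 3 \<Longrightarrow> norm (D 3 x vs) \<le> B * prod_list (map norm vs)"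
        using ml[OF x, of 3] unfolding bounded_multilinear_def by blast
      \<comment> \<open>Differentiability of \<open>D 2\<close> at \<open>x\<close> with tolerance
        1, together with the bound \<open>B\<close> on the third derivative, gives a Lipschitz
        estimate at \<open>x\<close>. The filter is \<open>nhds x\<close> rather than
        \<open>at x\<close> because \<open>fst z\<close> may equal \<open>x\<close> although
        \<open>z\<close> differs from \<open>(x, w)\<close>.\<close>
      have near: "\<forall>\<^sub>F y in nhds x. \<forall>v. norm (D 2 y [v, v] - D 2 x [v, v]) \<le> (1 + B) * norm (y - x) * (norm v)\<^sup>2"
        using D[OF x zero_less_one, of 2] unfolding eventually_at_filter
      proof eventually_elim
        case (elim y)
        show ?case
        proof (cases "y = x")
          case False
          have "norm (D 2 y [v, v] - D 2 x [v, v]) \<le> (1 + B) * norm (y - x) * (norm v)\<^sup>2" for v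
          proof -
            have "norm (D 2 y [v, v] - D 2 x [v, v] - D 3 x [y - x, v, v]) \<le> norm (y - x) * (norm v)\<^sup>2"
              using False elim[rule_format, of "[v, v]"] by (simp add: power2_eq_square)
            moreover have "norm (D 3 x [y - x, v, v]) \<le> B * norm (y - x) * (norm v)\<^sup>2"
              using B[of "[y - x, v, v]"] by (simp add: power2_eq_square)
            ultimately show ?thesis
              using norm_triangle_ineq[of "D 2 y [v, v] - D 2 x [v, v] - D 3 x [y - x, v, v]" "D 3 x [y - x, v, v]"]
              unfolding mult.assoc distrib_right mult_1 diff_add_cancel by linarith
          qed
          then show ?thesis by blast
        qed auto
      qed
      have fst: "(fst \<longlongrightarrow> x) ?F" and snd: "(snd \<longlongrightarrow> w) ?F"
        using tendsto_fst[OF tendsto_ident_at, of "(x, w)" UNIV]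
          tendsto_snd[OF tendsto_ident_at, of "(x, w)" UNIV] by simp_all
      have "\<forall>\<^sub>F z in ?F. norm (D 2 (fst z) [snd z, snd z] - D 2 x [snd z, snd z])
          \<le> (1 + B) * norm (fst z - x) * (norm (snd z))\<^sup>2"
        using eventually_compose_filterlim[OF near fst] by (rule eventually_mono) blast
      moreover have "((\<lambda>z. (1 + B) * norm (fst z - x) * (norm (snd z))\<^sup>2) \<longlongrightarrow> (1 + B) * norm (x - x) * (norm w)\<^sup>2) ?F"
        by (intro tendsto_intros fst snd)
      then have "((\<lambda>z. (1 + B) * norm (fst z - x) * (norm (snd z))\<^sup>2) \<longlongrightarrow> 0) ?F"
        unfolding diff_self norm_zero mult_zero_right mult_zero_left .
      ultimately have "((\<lambda>z. D 2 (fst z) [snd z, snd z] - D 2 x [snd z, snd z]) \<longlongrightarrow> 0) ?F"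
        by (rule Lim_null_comparison)
      \<comment> \<open>The form is split into its change of base point, which tends to 0, and the
        fixed bilinear form at \<open>x\<close>, which is continuous in the direction.\<close>
      from tendsto_add[OF this tendsto[OF snd snd]] show ?thesis
        unfolding isCont_def by simp
    qed
  qed
qed

text \<open>Unlike in uniform continuity on \<open>K\<close>, the point \<open>y\<close> need not lie in \<open>K\<close>.\<close>

lemma compact_isCont_uniform:
  fixes g :: "'a::metric_space \<Rightarrow> 'b::metric_space"
  assumes K: "compact K" and g: "\<And>x. x \<in> K \<Longrightarrow> isCont g x" and "\<epsilon> > 0"
  obtains \<delta> where "\<delta> > 0" "\<And>x y. x \<in> K \<Longrightarrow> dist x y < \<delta> \<Longrightarrow> dist (g y) (g x) < \<epsilon>"
proof -
  \<comment> \<open>The open sets on which \<open>g\<close> oscillates by less than \<epsilon> cover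
    \<open>K\<close>. A Lebesgue number \<open>e\<close> of this cover works:
    \<open>ball x e\<close> lies in a single such set, which then contains \<open>y\<close>
    too.\<close>
  define \<G> where "\<G> = {U. open U \<and> (\<forall>y\<in>U. \<forall>z\<in>U. dist (g y) (g z) < \<epsilon>)}"
  have "\<exists>U\<in>\<G>. x \<in> U" if "x \<in> K" for x
  proof -
    from g[OF that] \<open>\<epsilon> > 0\<close> obtain d where d: "d > 0" "\<And>y. dist y x < d \<Longrightarrow> dist (g y) (g x) < \<epsilon> / 2"
      unfolding continuous_at_eps_delta by (meson half_gt_zero)
    have "dist (g y) (g z) < \<epsilon>" if "y \<in> ball x d" "z \<in> ball x d" for y z
    proof -
      have "dist (g y) (g x) < \<epsilon> / 2" "dist (g z) (g x) < \<epsilon> / 2"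
        using that by (metis d(2) dist_commute mem_ball)+
      then show ?thesis by (rule dist_triangle_half_l)
    qed
    then have "ball x d \<in> \<G>"
      unfolding \<G>_def by blast
    moreover have "x \<in> ball x d"
      using d(1) by simp
    ultimately show ?thesis by blast
  qed
  then have "K \<subseteq> \<Union>\<G>" by blast
  moreover have "open U" if "U \<in> \<G>" for U
    using that unfolding \<G>_def by blast
  ultimately obtain e where e: "e > 0" "\<forall>x\<in>K. \<exists>U\<in>\<G>. ball x e \<subseteq> U"
    using Heine_Borel_lemma[OF K] by metis
  show thesis
  proof (rule that[OF e(1)])
    fix x y assume "x \<in> K" "dist x y < e"
    then obtain U where "U \<in> \<G>" "x \<in> U" "y \<in> U"
      using e centre_in_ball[of x e] mem_ball[of y x e] by blast
    then show "dist (g y) (g x) < \<epsilon>"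
      unfolding \<G>_def by blast
  qed
qed

lemma strongly_convex_ineq:
  fixes r :: "real \<Rightarrow> real"
  assumes "convex_on C (\<lambda>x. r x - \<mu> / 2 * x\<^sup>2)" "x \<in> C" "y \<in> C" "0 \<le> t" "t \<le> 1"
  shows "r ((1 - t) * x + t * y) \<le> (1 - t) * r x + t * r y - \<mu> / 2 * t * (1 - t) * (y - x)\<^sup>2"
proof -
  \<comment> \<open>Strong convexity is encoded as convexity after subtracting a parabola. This
    identity is the exact convexity defect of the square, which becomes the quadratic gain for
    \<open>r\<close>.\<close>
  have "((1 - t) * x + t * y)\<^sup>2 = (1 - t) * x\<^sup>2 + t * y\<^sup>2 - t * (1 - t) * (y - x)\<^sup>2"
    by (simp add: power2_eq_square algebra_simps)
  then have "\<mu> / 2 * ((1 - t) * x + t * y)\<^sup>2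
      = \<mu> / 2 * ((1 - t) * x\<^sup>2 + t * y\<^sup>2 - t * (1 - t) * (y - x)\<^sup>2)"
    by (rule arg_cong)
  also have "\<dots> = (1 - t) * (\<mu> / 2 * x\<^sup>2) + t * (\<mu> / 2 * y\<^sup>2) - \<mu> / 2 * t * (1 - t) * (y - x)\<^sup>2"
    by (simp add: field_simps)
  finally have "\<mu> / 2 * ((1 - t) * x + t * y)\<^sup>2 = \<dots>" .
  moreover have "r ((1 - t) * x + t * y) - \<mu> / 2 * ((1 - t) * x + t * y)\<^sup>2
      \<le> (1 - t) * (r x - \<mu> / 2 * x\<^sup>2) + t * (r y - \<mu> / 2 * y\<^sup>2)"
    using convex_onD[OF assms(1,4,5,2,3)] by simp
  ultimately show ?thesis
    unfolding right_diff_distrib[of _ "r _"] by linarith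
qed

text \<open>A root beyond 2 is handled by plain convexity, which makes \<open>r\<close> nonpositive
  at 2. On \<open>{0..2}\<close> the quadratic gain in the chord inequality does the rest:
  \<open>r\<close> is nonpositive at 0 and nearly 0 at 1, so a positive root far from 1 would
  contradict the gain.\<close>

lemma strongly_convex_root:
  fixes r :: "real \<Rightarrow> real"
  assumes conv: "convex_on UNIV r" and sconv: "convex_on {0..2} (\<lambda>x. r x - \<mu> / 2 * x\<^sup>2)"
    and \<mu>: "\<mu> > 0" and r0: "r 0 \<le> 0" and r1: "\<bar>r 1\<bar> \<le> \<epsilon>" "8 * \<epsilon> < \<mu>"
  shows strongly_convex_root_ex1: "\<exists>!\<gamma>. \<gamma> > 0 \<and> r \<gamma> = 0"
    and strongly_convex_root_near_1: "\<gamma> > 0 \<Longrightarrow> r \<gamma> = 0 \<Longrightarrow> \<bar>\<gamma> - 1\<bar> \<le> 2 * \<epsilon> / \<mu>"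
proof -
  note ineq = strongly_convex_ineq[OF sconv]
  have "\<epsilon> \<ge> 0" using r1 by linarith
  have near: "\<bar>\<gamma> - 1\<bar> \<le> 2 * \<epsilon> / \<mu> \<and> \<gamma> < 2" if \<gamma>: "\<gamma> > 0" "r \<gamma> = 0" for \<gamma>
  proof (cases "\<gamma> \<le> 1")
    case True
    \<comment> \<open>Both the gain and the term with \<open>r 1\<close> carry a factor \<gamma>.
      Dividing by it leaves a bound on 1 - \<gamma> that does not degrade for small
      \<gamma>.\<close>
    have "r \<gamma> \<le> (1 - \<gamma>) * r 0 + \<gamma> * r 1 - \<mu> / 2 * \<gamma> * (1 - \<gamma>)"
      using ineq[of 0 1 \<gamma>] True \<gamma> by simp
    moreover have "(1 - \<gamma>) * r 0 \<le> 0"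
      using True r0 by (simp add: mult_nonneg_nonpos)
    moreover have "\<gamma> * r 1 \<le> \<gamma> * \<epsilon>"
      using r1 \<gamma> by (intro mult_left_mono) auto
    ultimately have "\<mu> / 2 * \<gamma> * (1 - \<gamma>) \<le> \<gamma> * \<epsilon>"
      using \<gamma> by linarith
    then have "\<gamma> * (\<mu> / 2 * (1 - \<gamma>)) \<le> \<gamma> * \<epsilon>"
      by (simp only: mult_ac)
    then have "\<mu> / 2 * (1 - \<gamma>) \<le> \<epsilon>" using \<gamma>(1) by (rule mult_left_le_imp_le)
    then show ?thesis using True \<mu> by (simp add: field_simps)
  next
    case False
    \<comment> \<open>The root is truncated so that strong convexity applies on the segment from 0
      to \<open>\<gamma>'\<close>, in which 1 is an interior point.\<close>
    define \<gamma>' where "\<gamma>' = min \<gamma> 2"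
    have \<gamma>': "1 < \<gamma>'" "\<gamma>' \<le> 2" "\<gamma>' \<le> \<gamma>" using False by (auto simp: \<gamma>'_def)
    have "r ((1 - \<gamma>' / \<gamma>) *\<^sub>R 0 + (\<gamma>' / \<gamma>) *\<^sub>R \<gamma>) \<le> (1 - \<gamma>' / \<gamma>) * r 0 + \<gamma>' / \<gamma> * r \<gamma>"
      using \<gamma>' \<gamma> by (intro convex_onD[OF conv]) auto
    moreover have "(1 - \<gamma>' / \<gamma>) * r 0 \<le> 0"
      using \<gamma>' \<gamma> r0 by (intro mult_nonneg_nonpos) auto
    ultimately have r\<gamma>': "r \<gamma>' \<le> 0" using \<gamma> by simp
    have "r 1 \<le> (1 - 1 / \<gamma>') * r 0 + 1 / \<gamma>' * r \<gamma>' - \<mu> / 2 * (1 / \<gamma>') * (1 - 1 / \<gamma>') * \<gamma>'\<^sup>2"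
      using ineq[of 0 \<gamma>' "1 / \<gamma>'"] \<gamma>' by simp
    moreover have "(1 - 1 / \<gamma>') * r 0 \<le> 0"  "1 / \<gamma>' * r \<gamma>' \<le> 0"
      using r0 r\<gamma>' \<gamma>' by (auto intro!: mult_nonneg_nonpos simp: divide_nonpos_pos)
    moreover have "\<mu> / 2 * (1 / \<gamma>') * (1 - 1 / \<gamma>') * \<gamma>'\<^sup>2 = \<mu> / 2 * (\<gamma>' - 1)"
      using \<gamma>' by (simp add: field_simps power2_eq_square)
    ultimately have *: "\<mu> / 2 * (\<gamma>' - 1) \<le> \<epsilon>" using r1 by linarith
    have "\<gamma>' < 2"
    \<comment> \<open>If the truncation were active, the last estimate would read \<mu>/2 \<le>
      \<epsilon>, against the smallness of \<epsilon>.\<close>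
    proof (rule ccontr)
      assume "\<not> \<gamma>' < 2"
      with \<gamma>' have "\<gamma>' = 2" by simp
      with * r1 \<mu> \<open>\<epsilon> \<ge> 0\<close> show False by simp
    qed
    then have "\<gamma>' = \<gamma>" by (auto simp: \<gamma>'_def)
    with * \<open>\<gamma>' < 2\<close> \<mu> False show ?thesis by (simp add: field_simps)
  qed
  then show "\<gamma> > 0 \<Longrightarrow> r \<gamma> = 0 \<Longrightarrow> \<bar>\<gamma> - 1\<bar> \<le> 2 * \<epsilon> / \<mu>" by blast
  have "r (1/2) \<le> 1/2 * r 0 + 1/2 * r 1 - \<mu> / 8"
    using ineq[of 0 1 "1/2"] by simp
  then have half: "r (1/2) < 0" using r0 r1 by linarith
  \<comment> \<open>Solved for \<open>r (3/2)\<close>, this gives at least \<mu>/4 - 2\<epsilon>,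
    which is where the factor 8 in the smallness condition comes from.\<close>
  have "r 1 \<le> 1/2 * r (1/2) + 1/2 * r (3/2) - \<mu> / 8"
    using ineq[of "1/2" "3/2" "1/2"] by (simp add: power2_eq_square)
  then have "r (3/2) \<ge> 0" using half r1 \<mu> by linarith
  moreover have "continuous_on UNIV r"
    using conv by (intro convex_on_continuous) auto
  ultimately have "\<exists>x\<ge>1/2. x \<le> 3/2 \<and> r x = 0"
    using half by (intro IVT') (auto intro: continuous_on_subset)
  then obtain \<gamma> where "\<gamma> \<ge> 1/2" "r \<gamma> = 0" by auto
  then have \<gamma>: "\<gamma> > 0 \<and> r \<gamma> = 0" by simp
  \<comment> \<open>The smaller root would lie strictly inside the chord from 0 to the larger one,
    where the gain forces \<open>r\<close> to be negative. The bound b < 2 keeps the chord in the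
    range of strong convexity.\<close>
  have less: False if "0 < a" "a < b" "r a = 0" "r b = 0" for a b
  proof -
    have "b < 2" using near[of b] that by auto
    have "r a \<le> (1 - a / b) * r 0 + a / b * r b - \<mu> / 2 * (a / b) * (1 - a / b) * b\<^sup>2"
      using ineq[of 0 b "a / b"] that \<open>b < 2\<close> by simp
    moreover have "(1 - a / b) * r 0 \<le> 0"
      using that r0 by (intro mult_nonneg_nonpos) auto
    moreover have "\<mu> / 2 * (a / b) * (1 - a / b) * b\<^sup>2 > 0"
      using that \<mu> by (intro mult_pos_pos) auto
    ultimately show False using that by simp
  qed
  show "\<exists>!\<gamma>. \<gamma> > 0 \<and> r \<gamma> = 0"
  proof (rule ex1I, rule \<gamma>)
    show "x = \<gamma>" if "x > 0 \<and> r x = 0" for x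
      using less[of x \<gamma>] less[of \<gamma> x] that \<gamma> by (metis linorder_less_linear)
  qed
qed

text \<open>Taylor expansion with a remainder uniform over \<open>K\<close>: the second derivative
  of \<open>u\<close> is bounded by \<open>L\<close> on a compact neighbourhood of \<open>K\<close>,
  so the velocity varies by at most L \<rho> on \<open>cball T \<rho>\<close>, and the mean value
  inequality follows. The base point \<open>a\<close> is kept separate from \<open>T\<close> because
  the relaxed time is later compared with the new time while the velocity is frozen at the last
  time.\<close>

lemma ode_solution_linearization:
  fixes f :: "'a::banach \<Rightarrow> 'a"
  assumes sol: "ode_solution_on I f u" and K: "compact K" "K \<subseteq> I"
  obtains \<delta> L where "\<delta> > 0" "L \<ge> 0" "\<And>T. T \<in> K \<Longrightarrow> cball T \<delta> \<subseteq> I"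
    "\<And>T \<rho> a b. T \<in> K \<Longrightarrow> \<rho> \<le> \<delta> \<Longrightarrow> \<bar>a - T\<bar> \<le> \<rho> \<Longrightarrow> \<bar>b - T\<bar> \<le> \<rho> \<Longrightarrow>
       norm (u b - u a - (b - a) *\<^sub>R f (u T)) \<le> L * \<rho> * \<bar>b - a\<bar>"
proof -
  from sol have "open I" and smooth: "smooth_on I u"
    and ode: "\<And>t. t \<in> I \<Longrightarrow> (u has_vector_derivative f (u t)) (at t)"
    unfolding ode_solution_on_def by auto
  obtain u1 u2 where
    u1: "\<And>t. t \<in> I \<Longrightarrow> (u has_derivative u1 t) (at t)" and
    u2: "\<And>t w. t \<in> I \<Longrightarrow> ((\<lambda>s. u1 s w) has_derivative (\<lambda>v. u2 t v w)) (at t)" and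
    "\<And>t. t \<in> I \<Longrightarrow> bounded_bilinear (u2 t)" and
    cont: "\<And>t w. t \<in> I \<Longrightarrow> isCont (\<lambda>z. u2 (fst z) (snd z) (snd z)) (t, w)"
    by (rule smooth_on_C2[OF smooth \<open>open I\<close>], rule that)
  have u1_1: "u1 t 1 = f (u t)" if "t \<in> I" for t
    using has_derivative_unique[OF u1[OF that] ode[OF that, unfolded has_vector_derivative_def]] by simp
  \<comment> \<open>Here \<open>u2 t 1 1\<close> is the second derivative of \<open>u\<close> at
    \<open>t\<close>, written as the derivative of the velocity along the solution.\<close>
  have fu: "((\<lambda>s. f (u s)) has_vector_derivative u2 t 1 1) (at t)" if "t \<in> I" for t
  proof -
    have "u2 t v 1 = v *\<^sub>R u2 t 1 1" for v
      using linear_scale[OF has_derivative_linear[OF u2[OF that, of 1]], of v 1] by simp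
    then have "(\<lambda>v. u2 t v 1) = (\<lambda>v. v *\<^sub>R u2 t 1 1)"
      by (rule ext)
    with u2[OF that, of 1] have "((\<lambda>s. u1 s 1) has_vector_derivative u2 t 1 1) (at t)"
      unfolding has_vector_derivative_def by (rule subst[rotated])
    then show ?thesis
      by (rule has_vector_derivative_transform_within_open[OF _ \<open>open I\<close> that u1_1])
  qed
  obtain e where "e > 0" and e: "(\<Union>x\<in>K. ball x e) \<subseteq> I"
    using compact_subset_open_imp_ball_epsilon_subset[OF K(1) \<open>open I\<close> K(2)] by blast
  define \<delta> where "\<delta> = e / 2"
  have "\<delta> > 0" using \<open>e > 0\<close> by (simp add: \<delta>_def)
  have sub: "cball T \<delta> \<subseteq> I" if "T \<in> K" for T
  proof -
    have "cball T \<delta> \<subseteq> ball T e"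
      using \<open>e > 0\<close> by (auto simp: \<delta>_def)
    then show ?thesis using e that by blast
  qed
  \<comment> \<open>The closed \<delta>-neighbourhood of \<open>K\<close>, written as a sum of
    compact sets to obtain its compactness. Halving \<open>e\<close> keeps it inside
    \<open>I\<close>.\<close>
  define K' where "K' = {x + y |x y. x \<in> K \<and> y \<in> cball 0 \<delta>}"
  have "compact K'"
    unfolding K'_def using K(1) by (intro compact_sums) auto
  have in_K': "cball T \<delta> \<subseteq> K'" if "T \<in> K" for T
  proof
    fix s assume "s \<in> cball T \<delta>"
    then have "s = T + (s - T) \<and> T \<in> K \<and> s - T \<in> cball 0 \<delta>"
      using that by (simp add: dist_norm norm_minus_commute)
    then show "s \<in> K'"
      unfolding K'_def by blast
  qed
  have "K' \<subseteq> I"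
  proof
    fix s assume "s \<in> K'"
    then obtain x y where "s = x + y" "x \<in> K" "y \<in> cball 0 \<delta>" by (auto simp: K'_def)
    then have "s \<in> cball x \<delta>" by (simp add: dist_norm)
    then show "s \<in> I" using sub \<open>x \<in> K\<close> by blast
  qed
  have "continuous_on K' (\<lambda>t. u2 t 1 1)"
  proof (rule continuous_at_imp_continuous_on, rule ballI)
    fix t assume "t \<in> K'"
    then have "t \<in> I" using \<open>K' \<subseteq> I\<close> by blast
    have "isCont (\<lambda>t. (t, 1::real)) t"
      by (intro continuous_intros)
    from isCont_o2[OF this cont[OF \<open>t \<in> I\<close>]] show "isCont (\<lambda>t. u2 t 1 1) t"
      by simp
  qed
  then have "bounded ((\<lambda>t. u2 t 1 1) ` K')"
    using \<open>compact K'\<close> by (intro compact_imp_bounded compact_continuous_image)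
  then obtain L where L: "L > 0" "\<And>t. t \<in> K' \<Longrightarrow> norm (u2 t 1 1) \<le> L"
    unfolding bounded_pos by auto
  show thesis
  proof (rule that[OF \<open>\<delta> > 0\<close> less_imp_le[OF \<open>L > 0\<close>] sub])
    fix T \<rho> a b assume T: "T \<in> K" and "\<rho> \<le> \<delta>" and ab: "\<bar>a - T\<bar> \<le> \<rho>" "\<bar>b - T\<bar> \<le> \<rho>"
    then have "\<rho> \<ge> 0" by linarith
    have "cball T \<rho> \<subseteq> cball T \<delta>"
      using \<open>\<rho> \<le> \<delta>\<close> by (rule subset_cball)
    then have S: "s \<in> I" "s \<in> K'" if "s \<in> cball T \<rho>" for s
      using that sub[OF T] in_K'[OF T] by blast+
    have "norm (f (u s) - f (u T)) \<le> L * \<rho>" if s: "s \<in> cball T \<rho>" for s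
    proof -
      have "norm (f (u s) - f (u T)) \<le> L * norm (s - T)"
      proof (rule differentiable_bound[where S = "cball T \<rho>" and f' = "\<lambda>t v. v *\<^sub>R u2 t 1 1"])
        fix t assume t: "t \<in> cball T \<rho>"
        show "((\<lambda>s. f (u s)) has_derivative (\<lambda>v. v *\<^sub>R u2 t 1 1)) (at t within cball T \<rho>)"
          using fu[OF S(1)[OF t]] unfolding has_vector_derivative_def
          by (rule has_derivative_at_withinI)
        show "onorm (\<lambda>v. v *\<^sub>R u2 t 1 1) \<le> L"
          using L(2)[OF S(2)[OF t]] L(1) by (intro onorm_le) (simp add: mult.commute[of L] mult_left_mono)
      qed (use s \<open>\<rho> \<ge> 0\<close> in auto)
      also have "\<dots> \<le> L * \<rho>"
        using s L by (intro mult_left_mono) (auto simp: dist_norm abs_minus_commute)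
      finally show ?thesis .
    qed
    moreover have "closed_segment a b \<subseteq> cball T \<rho>"
      using ab by (intro closed_segment_subset) (auto simp: dist_real_def abs_minus_commute)
    ultimately have "norm (u b - u a - (b - a) *\<^sub>R f (u T)) \<le> norm (b - a) * (L * \<rho>)"
      using \<open>\<rho> \<ge> 0\<close> has_vector_derivative_at_within[OF ode[OF S(1)]]
      by (intro vector_differentiable_bound_linearization[where S = "cball T \<rho>" and f' = "\<lambda>t. f (u t)"]) simp_all
    then show "norm (u b - u a - (b - a) *\<^sub>R f (u T)) \<le> L * \<rho> * \<bar>b - a\<bar>"
      by (simp add: mult_ac)
  qed
qed

text \<open>The second derivative along the line is the Hessian form in direction \<open>d\<close>;
  the affine term drops out and the parabola removes exactly \<mu>.\<close>

lemma strongly_convex_along_line: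
  fixes \<eta> :: "'a::real_normed_vector \<Rightarrow> real"
  assumes \<eta>1: "\<And>x. (\<eta> has_derivative \<eta>1 x) (at x)"
    and \<eta>2: "\<And>x w. ((\<lambda>y. \<eta>1 y w) has_derivative (\<lambda>v. \<eta>2 x v w)) (at x)"
    and \<mu>: "\<And>s. s \<in> {a..b} \<Longrightarrow> \<mu> \<le> \<eta>2 (x + s *\<^sub>R d) d d"
  shows "convex_on {a..b} (\<lambda>s. \<eta> (x + s *\<^sub>R d) - (\<alpha> + s * \<beta>) - \<mu> / 2 * s\<^sup>2)"
proof (rule f''_ge0_imp_convex)
  have line: "((\<lambda>s. g (x + s *\<^sub>R d)) has_real_derivative g' d) (at s)"
    if g: "(g has_derivative g') (at (x + s *\<^sub>R d))" for g :: "'a \<Rightarrow> real" and g' s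
  proof -
    have "((\<lambda>s. x + s *\<^sub>R d) has_derivative (\<lambda>s. s *\<^sub>R d)) (at s)"
      by (auto intro!: derivative_eq_intros)
    from has_derivative_compose[OF this g]
    have "((\<lambda>s. g (x + s *\<^sub>R d)) has_derivative (\<lambda>s. g' (s *\<^sub>R d))) (at s)" .
    moreover have "(\<lambda>s. g' (s *\<^sub>R d)) = (*) (g' d)"
      using linear_scale[OF has_derivative_linear[OF g]] by (simp add: fun_eq_iff)
    ultimately show ?thesis
      by (simp add: has_field_derivative_def)
  qed
  show "((\<lambda>s. \<eta> (x + s *\<^sub>R d) - (\<alpha> + s * \<beta>) - \<mu> / 2 * s\<^sup>2) has_real_derivative
      \<eta>1 (x + s *\<^sub>R d) d - \<beta> - \<mu> * s) (at s)" for s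
    by (rule derivative_eq_intros line[OF \<eta>1] refl | simp)+
  show "((\<lambda>s. \<eta>1 (x + s *\<^sub>R d) d - \<beta> - \<mu> * s) has_real_derivative
      \<eta>2 (x + s *\<^sub>R d) d d - \<mu>) (at s)" for s
    by (rule derivative_eq_intros line[OF \<eta>2] refl | simp)+
  show "0 \<le> \<eta>2 (x + s *\<^sub>R d) d d - \<mu>" if "s \<in> {a..b}" for s
    using \<mu>[OF that] by simp
qed simp

lemma convex_along_line:
  fixes \<eta> :: "'a::real_vector \<Rightarrow> real"
  assumes "convex_on UNIV \<eta>"
  shows "convex_on UNIV (\<lambda>s. \<eta> (x + s *\<^sub>R d) - (\<alpha> + s * \<beta>))"
proof (rule convex_onI)
  fix t a b :: real assume "0 < t" "t < 1"
  have eq: "x + ((1 - t) *\<^sub>R a + t *\<^sub>R b) *\<^sub>R d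
      = (1 - t) *\<^sub>R (x + a *\<^sub>R d) + t *\<^sub>R (x + b *\<^sub>R d)"
    by (simp add: algebra_simps)
  have "\<eta> (x + ((1 - t) *\<^sub>R a + t *\<^sub>R b) *\<^sub>R d)
      \<le> (1 - t) * \<eta> (x + a *\<^sub>R d) + t * \<eta> (x + b *\<^sub>R d)"
    unfolding eq using \<open>0 < t\<close> \<open>t < 1\<close> by (intro convex_onD[OF assms]) auto
  then show "\<eta> (x + ((1 - t) *\<^sub>R a + t *\<^sub>R b) *\<^sub>R d) - (\<alpha> + ((1 - t) *\<^sub>R a + t *\<^sub>R b) * \<beta>)
      \<le> (1 - t) * (\<eta> (x + a *\<^sub>R d) - (\<alpha> + a * \<beta>)) + t * (\<eta> (x + b *\<^sub>R d) - (\<alpha> + b * \<beta>))"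
    by (simp add: algebra_simps)
qed simp

lemma previous_times_mono:
  assumes "previous_times N I \<tau>" "k \<le> N"
  shows "previous_times k I \<tau>"
proof -
  have "{1..<k} \<subseteq> {1..<N}" using assms(2) by auto
  with assms(1) show ?thesis
    unfolding previous_times_def by (auto elim!: eventually_mono)
qed

lemma previous_values_mono:
  assumes "previous_values N p u \<tau> v" "k \<le> N"
  shows "previous_values k p u \<tau> v"
  using assms unfolding previous_values_def by auto

text \<open>Telescoping: the induction adds one spacing bound to the constant \<open>A\<close>, so a
  single constant serves all the previous times.\<close>

lemma previous_times_bound:
  assumes "previous_times N I \<tau>"
  shows "\<exists>A\<ge>0. \<forall>\<^sub>F h in at_right 0. \<forall>j\<in>{1..N}. \<tau> h j \<le> \<tau> h 1 \<and> \<tau> h 1 - \<tau> h j \<le> A * h"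
  using assms
proof (induction N)
  case 0
  show ?case by (intro exI[of _ 0]) simp
next
  case (Suc N)
  then obtain A where A: "A \<ge> 0"
    "\<forall>\<^sub>F h in at_right 0. \<forall>j\<in>{1..N}. \<tau> h j \<le> \<tau> h 1 \<and> \<tau> h 1 - \<tau> h j \<le> A * h"
    using previous_times_mono[of "Suc N" I \<tau> N] by auto
  have pos: "\<forall>\<^sub>F h in at_right 0. h > (0::real)"
    by (rule eventually_at_right_less)
  show ?case
  proof (cases "N = 0")
    case True
    show ?thesis
      by (rule exI[of _ 0]) (simp add: True)
  next
    case False
    then have N: "N \<in> {1..<Suc N}" by simp
    have "(\<lambda>h. \<tau> h N - \<tau> h (Suc N)) \<in> O[at_right 0](\<lambda>h. h)"
      using Suc.prems N unfolding previous_times_def by blast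
    then obtain C where C: "C > 0" "\<forall>\<^sub>F h in at_right 0. norm (\<tau> h N - \<tau> h (Suc N)) \<le> C * norm h"
      by (rule landau_o.bigE)
    have "\<forall>\<^sub>F h in at_right 0. \<tau> h (Suc N) < \<tau> h N"
      using Suc.prems N unfolding previous_times_def by (auto elim!: eventually_mono)
    with A(2) C(2) pos
    have "\<forall>\<^sub>F h in at_right 0. \<forall>j\<in>{1..Suc N}. \<tau> h j \<le> \<tau> h 1 \<and> \<tau> h 1 - \<tau> h j \<le> (A + C) * h"
    proof eventually_elim
      case (elim h)
      have "C * h \<ge> 0" using C elim by simp
      have N': "\<tau> h N \<le> \<tau> h 1 \<and> \<tau> h 1 - \<tau> h N \<le> A * h"
        using elim(1) False by simp
      show ?case
      proof
        fix j assume "j \<in> {1..Suc N}"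
        then consider "j \<in> {1..N}" | "j = Suc N" by fastforce
        then show "\<tau> h j \<le> \<tau> h 1 \<and> \<tau> h 1 - \<tau> h j \<le> (A + C) * h"
        proof cases
          case 1
          then have "\<tau> h j \<le> \<tau> h 1 \<and> \<tau> h 1 - \<tau> h j \<le> A * h" using elim(1) by blast
          then show ?thesis using \<open>C * h \<ge> 0\<close> unfolding distrib_right by linarith
        next
          case 2
          have "\<tau> h N - \<tau> h (Suc N) \<le> C * h"
            using elim(2,3) by simp
          then show ?thesis
            using N' elim(4) unfolding 2 distrib_right by linarith
        qed
      qed
    qed
    then show ?thesis using A(1) C(1) by (intro exI[of _ "A + C"]) simp
  qed
qed

lemma bigo_finite_uniform:
  fixes g :: "'a \<Rightarrow> 'i \<Rightarrow> real"
  assumes "finite J" "\<And>j. j \<in> J \<Longrightarrow> (\<lambda>h. g h j) \<in> O[F](b)"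
  obtains C where "C > 0" "\<forall>\<^sub>F h in F. \<forall>j\<in>J. \<bar>g h j\<bar> \<le> C * \<bar>b h\<bar>"
proof -
  have "\<exists>C>0. \<forall>\<^sub>F h in F. \<bar>g h j\<bar> \<le> C * \<bar>b h\<bar>" if "j \<in> J" for j
    using assms(2)[OF that] by (elim landau_o.bigE) auto
  then obtain C where C: "\<And>j. j \<in> J \<Longrightarrow> C j > 0"
    "\<And>j. j \<in> J \<Longrightarrow> \<forall>\<^sub>F h in F. \<bar>g h j\<bar> \<le> C j * \<bar>b h\<bar>" by metis
  have "\<forall>\<^sub>F h in F. \<forall>j\<in>J. \<bar>g h j\<bar> \<le> C j * \<bar>b h\<bar>"
    using C(2) assms(1) by (intro eventually_ball_finite) auto
  \<comment> \<open>The sum dominates each single constant; the summand 1 keeps it positive for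
    empty \<open>J\<close>.\<close>
  then have "\<forall>\<^sub>F h in F. \<forall>j\<in>J. \<bar>g h j\<bar> \<le> (sum C J + 1) * \<bar>b h\<bar>"
  proof eventually_elim
    case (elim h)
    show ?case
    proof
      fix j assume j: "j \<in> J"
      have "C j \<le> sum C J"
        using j C(1) assms(1) by (intro member_le_sum) (auto intro: less_imp_le)
      then have "C j * \<bar>b h\<bar> \<le> (sum C J + 1) * \<bar>b h\<bar>"
        by (intro mult_right_mono) auto
      then show "\<bar>g h j\<bar> \<le> (sum C J + 1) * \<bar>b h\<bar>"
        using elim j by force
    qed
  qed
  moreover have "sum C J + 1 > 0"
    using C(1) by (intro add_nonneg_pos sum_nonneg) (auto intro: less_imp_le)
  ultimately show thesis using that by blast
qed

lemma norm_old_average_le: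
  assumes "\<And>i. i < m \<Longrightarrow> \<nu> i \<ge> 0" "(\<Sum>i<m. \<nu> i) = 1"
    and "\<And>j. j \<in> {1..m} \<Longrightarrow> norm (x j) \<le> b"
  shows "norm (old_average m \<nu> x) \<le> b"
proof -
  have "norm (old_average m \<nu> x) \<le> (\<Sum>i<m. \<nu> i * b)"
    unfolding old_average_def
  proof (rule sum_norm_le)
    fix i assume "i \<in> {..<m}"
    then show "norm (\<nu> i *\<^sub>R x (m - i)) \<le> \<nu> i * b"
      using assms(1)[of i] assms(3)[of "m - i"] by (simp add: mult_left_mono)
  qed
  also have "\<dots> = b"
    using assms(2) by (simp flip: sum_distrib_right)
  finally show ?thesis .
qed

lemma old_average_le:
  assumes "\<And>i. i < m \<Longrightarrow> \<nu> i \<ge> 0" "(\<Sum>i<m. \<nu> i) = 1"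
    and "\<And>j. j \<in> {1..m} \<Longrightarrow> x j \<le> (b::real)"
  shows "old_average m \<nu> x \<le> b"
proof -
  have "old_average m \<nu> x \<le> (\<Sum>i<m. \<nu> i * b)"
    unfolding old_average_def
  proof (rule sum_mono)
    fix i assume "i \<in> {..<m}"
    then show "\<nu> i *\<^sub>R x (m - i) \<le> \<nu> i * b"
      using assms(1)[of i] assms(3)[of "m - i"] by (simp add: mult_left_mono)
  qed
  also have "\<dots> = b"
    using assms(2) by (simp flip: sum_distrib_right)
  finally show ?thesis .
qed

text \<open>Weights of total mass one fix constants, so averaging commutes with subtracting an
  affine function of time. The linearization error of an average is thereby the average of the
  errors.\<close>

lemma old_average_affine:
  assumes "(\<Sum>i<m. \<nu> i) = 1"
  shows "old_average m \<nu> (\<lambda>j. x j - y - (s j - T) *\<^sub>R w)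
    = old_average m \<nu> x - y - (old_average m \<nu> s - T) *\<^sub>R w"
proof -
  have y: "(\<Sum>i<m. \<nu> i *\<^sub>R y) = y"
    using assms by (simp flip: scaleR_sum_left)
  have T: "(\<Sum>i<m. \<nu> i * (s (m - i) - T)) = (\<Sum>i<m. \<nu> i * s (m - i)) - T"
    using assms by (simp add: right_diff_distrib sum_subtractf flip: sum_distrib_right)
  show ?thesis
    unfolding old_average_def scaleR_right_diff_distrib sum_subtractf y scaleR_scaleR
      scaleR_sum_left[symmetric] T real_scaleR_def assms scaleR_one ..
qed

text \<open>Jensen's inequality in the form that makes the relaxation residual nonpositive at
  \<gamma> = 0.\<close>

lemma convex_old_average:
  assumes "convex_on UNIV \<eta>" "m \<ge> 1" "\<And>i. i < m \<Longrightarrow> \<nu> i \<ge> 0" "(\<Sum>i<m. \<nu> i) = 1"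
  shows "\<eta> (old_average m \<nu> x) \<le> old_average m \<nu> (\<lambda>j. \<eta> (x j))"
proof -
  have "{..<m} \<noteq> {}" using assms(2) by (simp add: lessThan_empty_iff)
  with convex_on_sum[OF finite_lessThan this assms(1,4), of "\<lambda>i. x (m - i)"] assms(3)
  show ?thesis by (simp add: old_average_def)
qed

lemma old_average_linearization:
  fixes u :: "real \<Rightarrow> 'a::real_normed_vector"
  assumes weights: "\<And>i. i < m \<Longrightarrow> \<nu> i \<ge> 0" "(\<Sum>i<m. \<nu> i) = 1"
    and lin: "\<And>b. \<bar>b - T\<bar> \<le> \<rho> \<Longrightarrow> norm (u b - u T - (b - T) *\<^sub>R w) \<le> L * \<rho> * \<bar>b - T\<bar>"
    and nonneg: "L \<ge> 0" "\<rho> \<ge> 0"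
    and \<tau>: "\<And>j. j \<in> {1..m} \<Longrightarrow> \<bar>\<tau> j - T\<bar> \<le> \<rho>"
    and v: "\<And>j. j \<in> {1..m} \<Longrightarrow> norm (v j - u (\<tau> j)) \<le> \<epsilon>"
  shows "norm (old_average m \<nu> v - u T - (old_average m \<nu> \<tau> - T) *\<^sub>R w) \<le> \<epsilon> + L * \<rho>\<^sup>2"
  unfolding old_average_affine[OF weights(2), symmetric]
proof (rule norm_old_average_le[OF weights])
  fix j assume j: "j \<in> {1..m}"
  have "norm (u (\<tau> j) - u T - (\<tau> j - T) *\<^sub>R w) \<le> L * \<rho> * \<bar>\<tau> j - T\<bar>"
    by (rule lin[OF \<tau>[OF j]])
  also have "\<dots> \<le> L * \<rho> * \<rho>"
    using nonneg \<tau>[OF j] by (intro mult_left_mono) auto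
  finally have "norm (u (\<tau> j) - u T - (\<tau> j - T) *\<^sub>R w) \<le> L * \<rho>\<^sup>2"
    by (simp add: power2_eq_square)
  moreover have "norm (v j - u T - (\<tau> j - T) *\<^sub>R w)
      = norm ((v j - u (\<tau> j)) + (u (\<tau> j) - u T - (\<tau> j - T) *\<^sub>R w))"
    by (simp add: algebra_simps)
  ultimately show "norm (v j - u T - (\<tau> j - T) *\<^sub>R w) \<le> \<epsilon> + L * \<rho>\<^sup>2"
    using v[OF j] norm_triangle_ineq[of "v j - u (\<tau> j)" "u (\<tau> j) - u T - (\<tau> j - T) *\<^sub>R w"]
    by linarith
qed

text \<open>Links \<open>second_derivative\<close>, in which non-degeneracy is phrased, to the
  derivatives supplied by \<open>smooth_on_C2\<close>.\<close>

lemma second_derivative_eq: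
  assumes "\<And>x. (g has_derivative g1 x) (at x)"
    and "\<And>x w. ((\<lambda>y. g1 y w) has_derivative (\<lambda>v. g2 x v w)) (at x)"
  shows "second_derivative g x v w = g2 x v w"
proof -
  have "frechet_derivative g (at y) = g1 y" for y
    using frechet_derivative_at[OF assms(1)] by simp
  then show ?thesis
    unfolding second_derivative_def
    by (simp flip: frechet_derivative_at[OF assms(2)[of w x]])
qed

lemma eventually_at_right_0_mult_less:
  fixes a e :: real
  assumes "e > 0"
  shows "\<forall>\<^sub>F h in at_right 0. h * a < e"
proof -
  have "((\<lambda>h. h * a) \<longlongrightarrow> 0 * a) (at_right 0)"
    by (intro tendsto_intros)
  then show ?thesis
    using assms by (intro order_tendstoD(2)[of _ "0 * a"]) auto
qed

lemma norm_add_diff_le: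
  fixes a b c :: "'a::real_normed_vector"
  shows "norm (a + b - c) \<le> norm a + norm b + norm c"
  using norm_triangle_ineq4[of "a + b" c] norm_triangle_ineq[of a b] by linarith

theorem theorem2p13:
  fixes f :: "'a::banach \<Rightarrow> 'a"
    and \<psi> :: "'a integrator"
    and G :: "(real \<Rightarrow> nat \<Rightarrow> real) set"
    and k p m :: nat
    and I :: "real set"
    and u :: "real \<Rightarrow> 'a"
    and \<eta> :: "'a \<Rightarrow> real"
    and \<nu> :: "nat \<Rightarrow> real"
    and \<tau> :: "real \<Rightarrow> nat \<Rightarrow> real"
    and v :: "real \<Rightarrow> nat \<Rightarrow> 'a"
    and t_new t_old \<eta>_new \<eta>_old :: "real \<Rightarrow> real"
    and u_new u_old :: "real \<Rightarrow> 'a"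
    and c :: real
  assumes smooth_f: "smooth_on UNIV f"
    and steps: "k \<ge> 1"
    and order: "p \<ge> 2" "method_of_order k p G \<psi> f"
    and entropy: "convex_entropy \<eta>"
    and solution: "ode_solution_on I f u"
    and weights: "m \<ge> 1" "\<And>i. i < m \<Longrightarrow> \<nu> i \<ge> 0" "(\<Sum>i<m. \<nu> i) = 1"
    and times: "\<tau> \<in> G" "previous_times (max k m) I \<tau>"
    and vals: "previous_values (max k m) p u \<tau> v"
    and t_new: "\<And>h. t_new h = \<tau> h 1 + h"
    and u_new: "\<And>h. u_new h = new_value k \<psi> f \<tau> v h"
    and t_old: "\<And>h. t_old h = old_average m \<nu> (\<tau> h)"
    and u_old: "\<And>h. u_old h = old_average m \<nu> (v h)"
    and \<eta>_old: "\<And>h. \<eta>_old h = old_average m \<nu> (\<lambda>j. \<eta> (v h j))"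
    and \<eta>_new: "(\<lambda>h. \<eta>_new h - \<eta> (u_new h)) \<in> O[at_right 0](\<lambda>h. h ^ (p + 1))"
    and nondegenerate: "c > 0"
      "\<forall>\<^sub>F h in at_right 0. second_derivative \<eta> (u_old h) (f (u_old h)) (f (u_old h)) \<ge> c"
  shows "(\<forall>\<^sub>F h in at_right 0. \<exists>!\<gamma>. \<gamma> > 0 \<and>
            \<eta> (u_old h + \<gamma> *\<^sub>R (u_new h - u_old h)) = \<eta>_old h + \<gamma> * (\<eta>_new h - \<eta>_old h)) \<and>
         (\<forall>\<gamma>. (\<forall>\<^sub>F h in at_right 0. \<gamma> h > 0 \<and>
            \<eta> (u_old h + \<gamma> h *\<^sub>R (u_new h - u_old h)) = \<eta>_old h + \<gamma> h * (\<eta>_new h - \<eta>_old h)) \<longrightarrow>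
            (\<forall>\<^sub>F h in at_right 0. t_old h + \<gamma> h * (t_new h - t_old h) \<in> I) \<and>
            (\<lambda>h. norm (u_old h + \<gamma> h *\<^sub>R (u_new h - u_old h)
                        - u (t_old h + \<gamma> h * (t_new h - t_old h))))
              \<in> O[at_right 0](\<lambda>h. h ^ (p + 1)))"
proof -

  \<comment> \<open>Uniform constants from the hypotheses\<close>
  define N where "N = max k m"
  have N: "k \<le> N" "m \<le> N" "1 \<le> N" using steps by (auto simp: N_def)
  note times' = times(2)[folded N_def] and vals' = vals[folded N_def]
  obtain K where K: "compact K" "K \<subseteq> I" and T_in_K: "\<forall>\<^sub>F h in at_right 0. \<tau> h 1 \<in> K"
    using times' unfolding previous_times_def by blast
  obtain \<delta> L where \<delta>: "\<delta> > 0" and L: "L \<ge> 0" and in_I: "\<And>T. T \<in> K \<Longrightarrow> cball T \<delta> \<subseteq> I"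
    and lin: "\<And>T \<rho> a b. T \<in> K \<Longrightarrow> \<rho> \<le> \<delta> \<Longrightarrow> \<bar>a - T\<bar> \<le> \<rho> \<Longrightarrow> \<bar>b - T\<bar> \<le> \<rho> \<Longrightarrow>
       norm (u b - u a - (b - a) *\<^sub>R f (u T)) \<le> L * \<rho> * \<bar>b - a\<bar>"
    using ode_solution_linearization[OF solution K] by blast
  obtain A where A: "A \<ge> 0" and \<tau>_bound:
      "\<forall>\<^sub>F h in at_right 0. \<forall>j\<in>{1..N}. \<tau> h j \<le> \<tau> h 1 \<and> \<tau> h 1 - \<tau> h j \<le> A * h"
    using previous_times_bound[OF times'] by blast
  obtain C\<^sub>v where C\<^sub>v: "C\<^sub>v > 0" and v_bound:
      "\<forall>\<^sub>F h in at_right 0. \<forall>j\<in>{1..N}. \<bar>norm (v h j - u (\<tau> h j))\<bar> \<le> C\<^sub>v * \<bar>h ^ (p + 1)\<bar>"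
    by (rule bigo_finite_uniform[of "{1..N}" "\<lambda>h j. norm (v h j - u (\<tau> h j))"])
       (use vals' in \<open>auto simp: previous_values_def\<close>)
  have "(\<lambda>h. norm (u_new h - u (t_new h))) \<in> O[at_right 0](\<lambda>h. h ^ (p + 1))"
    using order(2) solution times(1) previous_times_mono[OF times' N(1)]
      previous_values_mono[OF vals' N(1)]
    unfolding method_of_order_def u_new t_new by blast
  then obtain C\<^sub>u where C\<^sub>u: "C\<^sub>u > 0" and u_new_bound:
      "\<forall>\<^sub>F h in at_right 0. norm (norm (u_new h - u (t_new h))) \<le> C\<^sub>u * norm (h ^ (p + 1))"
    by (rule landau_o.bigE)
  obtain C\<^sub>\<eta> where C\<^sub>\<eta>: "C\<^sub>\<eta> > 0" and \<eta>_new_bound: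
      "\<forall>\<^sub>F h in at_right 0. norm (\<eta>_new h - \<eta> (u_new h)) \<le> C\<^sub>\<eta> * norm (h ^ (p + 1))"
    using \<eta>_new by (rule landau_o.bigE)
  obtain f1 where "\<And>x. x \<in> UNIV \<Longrightarrow> (f has_derivative f1 x) (at x)"
    by (rule smooth_on_C2[OF smooth_f open_UNIV], rule that)
  then have cont_f: "isCont f x" for x
    using has_derivative_continuous by blast
  have cont_u: "continuous_on K u"
  proof (rule continuous_at_imp_continuous_on, rule ballI)
    fix t assume "t \<in> K"
    then have "(u has_vector_derivative f (u t)) (at t)"
      using solution K(2) unfolding ode_solution_on_def by blast
    then show "isCont u t" by (rule has_vector_derivative_continuous)
  qed
  have "continuous_on UNIV f"
    using cont_f by (simp add: continuous_on_eq_continuous_at)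
  then have cont_fu: "continuous_on K (\<lambda>t. f (u t))"
    using cont_u by (rule continuous_on_compose2) simp
  obtain F where F: "F > 0" "\<And>t. t \<in> K \<Longrightarrow> norm (f (u t)) \<le> F"
    using compact_imp_bounded[OF compact_continuous_image[OF cont_fu K(1)]]
    unfolding bounded_pos by auto

  \<comment> \<open>Increments to leading order\<close>
  define w where "w h = f (u (\<tau> h 1))" for h
  define d where "d h = u_new h - u_old h" for h
  define H where "H h = t_new h - t_old h" for h
  \<comment> \<open>\<open>B\<close> bounds the linearization error of \<open>u_old\<close>: value
    errors plus Taylor remainders at distance A h. \<open>M\<close> adds the error of
    \<open>u_new\<close> and the remainder over the step h.\<close>
  define B where "B = C\<^sub>v + L * A\<^sup>2"
  define M where "M = C\<^sub>u + L + B"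
  have "B \<ge> 0" unfolding B_def using C\<^sub>v L by simp
  have "M \<ge> 0" unfolding M_def using \<open>B \<ge> 0\<close> C\<^sub>u L by simp
  have h_pos: "\<forall>\<^sub>F h in at_right 0. h > (0::real)"
    by (rule eventually_at_right_less)

  have increments: "\<forall>\<^sub>F h in at_right 0. 0 < h \<and> h \<le> 1 \<and> \<tau> h 1 \<in> K \<and> (2 + A) * h \<le> \<delta> \<and>
      h \<le> H h \<and> H h \<le> (1 + A) * h \<and>
      norm (u_old h - u (\<tau> h 1)) \<le> (B + A * F) * h \<and> norm (d h - H h *\<^sub>R w h) \<le> M * h\<^sup>2 \<and>
      norm (u_new h - u (t_new h)) \<le> C\<^sub>u * h ^ (p + 1)"
    using h_pos T_in_K \<tau>_bound v_bound u_new_bound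
      eventually_at_right_0_mult_less[OF \<delta>, of "2 + A"]
      eventually_at_right_0_mult_less[OF zero_less_one, of 1]
  proof eventually_elim
    case (elim h)
    note T = elim(2)
    have h: "0 < h" "h \<le> 1" using elim by auto
    have \<delta>h: "(2 + A) * h \<le> \<delta>" using elim by (simp add: mult.commute)
    have Ah: "0 \<le> A * h" "A * h \<le> \<delta>" "h \<le> \<delta>"
      using \<delta>h A h mult_nonneg_nonneg[of A h] unfolding distrib_right by linarith+
    have hp: "h ^ (p + 1) \<le> h\<^sup>2"
      using h order(1) by (intro power_decreasing) auto
    have h2: "h\<^sup>2 \<le> h"
      using h by (simp add: power2_eq_square mult_left_le)
    have \<tau>j: "\<tau> h j \<le> \<tau> h 1" "\<bar>\<tau> h j - \<tau> h 1\<bar> \<le> A * h" if "j \<in> {1..m}" for j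
    proof -
      have "j \<in> {1..N}" using that N(2) by simp
      with elim(3) show "\<tau> h j \<le> \<tau> h 1" "\<bar>\<tau> h j - \<tau> h 1\<bar> \<le> A * h" by auto
    qed
    have vj: "norm (v h j - u (\<tau> h j)) \<le> C\<^sub>v * h\<^sup>2" if "j \<in> {1..m}" for j
    proof -
      have "j \<in> {1..N}" using that N(2) by simp
      then have "norm (v h j - u (\<tau> h j)) \<le> C\<^sub>v * h ^ (p + 1)"
        using elim(4) h by simp
      also have "\<dots> \<le> C\<^sub>v * h\<^sup>2"
        using hp C\<^sub>v by (intro mult_left_mono) auto
      finally show ?thesis .
    qed
    have t_old_le: "t_old h \<le> \<tau> h 1"
      unfolding t_old by (rule old_average_le[OF weights(2,3) \<tau>j(1)])
    have "norm (old_average m \<nu> (\<lambda>j. \<tau> h j - \<tau> h 1)) \<le> A * h"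
    proof (rule norm_old_average_le[OF weights(2,3)])
      show "norm (\<tau> h j - \<tau> h 1) \<le> A * h" if "j \<in> {1..m}" for j
        unfolding real_norm_def using that by (rule \<tau>j(2))
    qed
    then have t_old_near: "\<bar>t_old h - \<tau> h 1\<bar> \<le> A * h"
      \<comment> \<open>With a zero affine slope the identity just says that the average of the
        centred times is the centred average.\<close>
      using old_average_affine[OF weights(3), of "\<tau> h" "\<tau> h 1" "\<lambda>_. 0" 0 0]
      by (simp add: t_old)
    have Hh: "h \<le> H h" "H h \<le> (1 + A) * h"
      using t_old_le t_old_near unfolding H_def t_new distrib_right by linarith+
    have old: "norm (u_old h - u (\<tau> h 1) - (t_old h - \<tau> h 1) *\<^sub>R w h) \<le> B * h\<^sup>2"
    proof -
      have "norm (u_old h - u (\<tau> h 1) - (t_old h - \<tau> h 1) *\<^sub>R w h) \<le> C\<^sub>v * h\<^sup>2 + L * (A * h)\<^sup>2"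
        unfolding u_old t_old w_def
        by (rule old_average_linearization[OF weights(2,3) lin[OF T Ah(2)] L Ah(1) \<tau>j(2) vj])
           (use Ah in auto)
      then show ?thesis
        by (simp add: B_def power_mult_distrib algebra_simps)
    qed
    have new: "norm (u_new h - u (t_new h)) \<le> C\<^sub>u * h ^ (p + 1)"
      using elim(5) h by simp
    have "norm (u_old h - u (\<tau> h 1)) \<le> (B + A * F) * h"
    proof -
      have "norm ((t_old h - \<tau> h 1) *\<^sub>R w h) \<le> (A * h) * F"
        unfolding norm_scaleR w_def real_norm_def
        using t_old_near F(2)[OF T] Ah(1) by (intro mult_mono) auto
      also have "\<dots> = (A * F) * h" by simp
      finally have "norm ((t_old h - \<tau> h 1) *\<^sub>R w h) \<le> (A * F) * h" .
      moreover have "B * h\<^sup>2 \<le> B * h"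
        using h2 \<open>B \<ge> 0\<close> by (rule mult_left_mono)
      ultimately show ?thesis
        using old norm_triangle_sub[of "u_old h - u (\<tau> h 1)" "(t_old h - \<tau> h 1) *\<^sub>R w h"]
        unfolding distrib_right by linarith
    qed
    moreover have "norm (d h - H h *\<^sub>R w h) \<le> M * h\<^sup>2"
    proof -
      have "d h - H h *\<^sub>R w h = (u_new h - u (t_new h))
          + (u (t_new h) - u (\<tau> h 1) - (t_new h - \<tau> h 1) *\<^sub>R w h)
          - (u_old h - u (\<tau> h 1) - (t_old h - \<tau> h 1) *\<^sub>R w h)"
        by (simp add: d_def H_def algebra_simps)
      then have "norm (d h - H h *\<^sub>R w h) \<le> norm (u_new h - u (t_new h))
          + norm (u (t_new h) - u (\<tau> h 1) - (t_new h - \<tau> h 1) *\<^sub>R w h)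
          + norm (u_old h - u (\<tau> h 1) - (t_old h - \<tau> h 1) *\<^sub>R w h)"
        by (simp only: norm_add_diff_le)
      moreover have "norm (u (t_new h) - u (\<tau> h 1) - (t_new h - \<tau> h 1) *\<^sub>R w h) \<le> L * h\<^sup>2"
        using lin[OF T Ah(3), of "\<tau> h 1" "t_new h"] h
        by (simp add: t_new w_def power2_eq_square mult.assoc)
      moreover have "C\<^sub>u * h ^ (p + 1) \<le> C\<^sub>u * h\<^sup>2"
        using hp C\<^sub>u by (intro mult_left_mono) auto
      ultimately show ?thesis
        using old new unfolding M_def distrib_right by linarith
    qed
    ultimately show ?case
      using h T \<delta>h Hh new by blast
  qed

  \<comment> \<open>Curvature of the entropy along the update direction\<close>
  have smooth_\<eta>: "smooth_on UNIV \<eta>" and convex: "convex_on UNIV \<eta>"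
    using entropy unfolding convex_entropy_def by auto
  obtain \<eta>1 \<eta>2 where
    \<eta>1: "\<And>x. x \<in> UNIV \<Longrightarrow> (\<eta> has_derivative \<eta>1 x) (at x)" and
    \<eta>2: "\<And>x w. x \<in> UNIV \<Longrightarrow> ((\<lambda>y. \<eta>1 y w) has_derivative (\<lambda>v. \<eta>2 x v w)) (at x)" and
    bil: "\<And>x. x \<in> UNIV \<Longrightarrow> bounded_bilinear (\<eta>2 x)" and
    cont_\<eta>2: "\<And>x w. x \<in> UNIV \<Longrightarrow> isCont (\<lambda>z. \<eta>2 (fst z) (snd z) (snd z)) (x, w)"
    by (rule smooth_on_C2[OF smooth_\<eta> open_UNIV], rule that)
  have curv: "second_derivative \<eta> x v w = \<eta>2 x v w" for x v w
    by (rule second_derivative_eq[OF \<eta>1[OF UNIV_I] \<eta>2[OF UNIV_I]])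
  define q where "q z = \<eta>2 (fst z) (snd z) (snd z)" for z
  have compact_pairs: "compact ((\<lambda>t. (u t, f (u t))) ` K)"
    using cont_u cont_fu K(1) by (intro compact_continuous_image continuous_on_Pair)
  have cont_q: "isCont q z" for z
    using cont_\<eta>2[OF UNIV_I, of "fst z" "snd z"] unfolding q_def[abs_def] prod.collapse .
  \<comment> \<open>The tolerance c/4 is spent twice: moving from \<open>u_old\<close> to the
    solution curve lowers the bound from c to 3c/4, and moving to the points on the update line
    lowers it to c/2.\<close>
  obtain \<delta>\<^sub>q where \<delta>\<^sub>q: "\<delta>\<^sub>q > 0"
    "\<And>x y. x \<in> (\<lambda>t. (u t, f (u t))) ` K \<Longrightarrow> dist x y < \<delta>\<^sub>q \<Longrightarrow> dist (q y) (q x) < c / 4"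
    using nondegenerate(1) by (auto intro: compact_isCont_uniform[OF compact_pairs cont_q, of "c / 4"])
  obtain \<delta>\<^sub>f where \<delta>\<^sub>f: "\<delta>\<^sub>f > 0"
    "\<And>x y. x \<in> u ` K \<Longrightarrow> dist x y < \<delta>\<^sub>f \<Longrightarrow> dist (f y) (f x) < \<delta>\<^sub>q / 2"
    by (rule compact_isCont_uniform[OF compact_continuous_image[OF cont_u K(1)] cont_f half_gt_zero[OF \<delta>\<^sub>q(1)]],
        rule that)
  have q_near: "\<bar>q (y, e) - q (u t, f (u t))\<bar> < c / 4"
    if "t \<in> K" "norm (y - u t) + norm (e - f (u t)) < \<delta>\<^sub>q" for t y e
  proof -
    have "dist (u t, f (u t)) (y, e) \<le> norm (y - u t) + norm (e - f (u t))"
      using norm_Pair_le[of "u t - y" "f (u t) - e"] by (simp add: dist_norm norm_minus_commute)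
    then show ?thesis
      unfolding dist_real_def[symmetric] using that by (intro \<delta>\<^sub>q(2)) auto
  qed

  \<comment> \<open>Up to a factor h, the summands bound the distance of \<open>u_old\<close> from
    the curve, the length of \<open>s *\<^sub>R d h\<close> for s \<le> 2, and the distance of the
    normalised direction from \<open>w\<close>.\<close>
  define R where "R = B + A * F + 2 * ((1 + A) * F + M) + M"
  have R: "B + A * F \<le> R"
    unfolding R_def using \<open>M \<ge> 0\<close> A F(1) by auto
  have curvature: "\<forall>\<^sub>F h in at_right 0.
      \<forall>s\<in>{0..2}. c / 2 * h\<^sup>2 \<le> \<eta>2 (u_old h + s *\<^sub>R d h) (d h) (d h)"
    using increments nondegenerate(2) eventually_at_right_0_mult_less[OF \<delta>\<^sub>f(1), of R]
      eventually_at_right_0_mult_less[OF half_gt_zero[OF \<delta>\<^sub>q(1)], of R]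
  proof eventually_elim
    case (elim h)
    then have h: "0 < h" "h \<le> 1" and T: "\<tau> h 1 \<in> K" and H: "h \<le> H h" "H h \<le> (1 + A) * h"
      and old: "norm (u_old h - u (\<tau> h 1)) \<le> (B + A * F) * h"
      and dH: "norm (d h - H h *\<^sub>R w h) \<le> M * h\<^sup>2"
      by auto
    have "H h > 0" using h H by linarith
    have "(B + A * F) * h \<le> h * R"
      using R(1) h by (simp add: mult.commute)
    then have "norm (u_old h - u (\<tau> h 1)) < \<delta>\<^sub>f" "norm (u_old h - u (\<tau> h 1)) < \<delta>\<^sub>q / 2"
      using old elim(3,4) by linarith+
    moreover from this have "norm (f (u_old h) - f (u (\<tau> h 1))) < \<delta>\<^sub>q / 2"
      using \<delta>\<^sub>f(2)[of "u (\<tau> h 1)" "u_old h"] T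
      unfolding dist_norm norm_minus_commute[of "u (\<tau> h 1)" "u_old h"] by blast
    ultimately have "\<bar>q (u_old h, f (u_old h)) - q (u (\<tau> h 1), f (u (\<tau> h 1)))\<bar> < c / 4"
      by (intro q_near[OF T]) linarith
    moreover have "q (u_old h, f (u_old h)) \<ge> c"
      using elim(2) by (simp add: curv q_def)
    ultimately have q_u: "q (u (\<tau> h 1), f (u (\<tau> h 1))) \<ge> 3 / 4 * c" by linarith
    have h2: "h\<^sup>2 \<le> h"
      using h by (simp add: power2_eq_square mult_left_le)
    have "norm (d h) \<le> M * h\<^sup>2 + H h * F"
    proof -
      have "norm (H h *\<^sub>R w h) \<le> H h * F"
        using \<open>H h > 0\<close> F(2)[OF T] by (simp add: w_def)
      then show ?thesis
        using dH norm_triangle_sub[of "d h" "H h *\<^sub>R w h"] by linarith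
    qed
    also have "\<dots> \<le> M * h + ((1 + A) * h) * F"
      using h2 \<open>M \<ge> 0\<close> H F(1) by (intro add_mono mult_left_mono mult_right_mono) auto
    finally have norm_d: "norm (d h) \<le> ((1 + A) * F + M) * h"
      by (simp add: algebra_simps)
    define e where "e = d h /\<^sub>R H h"
    have d_e: "d h = H h *\<^sub>R e"
      using \<open>H h > 0\<close> by (simp add: e_def)
    have e_near: "norm (e - w h) \<le> M * h"
    proof -
      have "h * norm (e - w h) \<le> H h * norm (e - w h)"
        using H by (intro mult_right_mono) auto
      also have "\<dots> = norm (d h - H h *\<^sub>R w h)"
        using \<open>H h > 0\<close> by (simp add: d_e flip: scaleR_right_diff_distrib)
      also have "\<dots> \<le> h * (M * h)"
        using dH by (simp add: power2_eq_square mult_ac)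
      finally show ?thesis using h(1) by (simp add: mult_le_cancel_left_pos)
    qed
    show ?case
    proof
      fix s :: real assume s: "s \<in> {0..2}"
      have "norm (s *\<^sub>R d h) \<le> 2 * (((1 + A) * F + M) * h)"
        unfolding norm_scaleR using s norm_d by (intro mult_mono) auto
      then have "norm (u_old h + s *\<^sub>R d h - u (\<tau> h 1)) \<le> (B + A * F) * h + 2 * (((1 + A) * F + M) * h)"
        using old norm_triangle_ineq[of "u_old h - u (\<tau> h 1)" "s *\<^sub>R d h"]
        by (simp add: algebra_simps)
      then have "norm (u_old h + s *\<^sub>R d h - u (\<tau> h 1)) + norm (e - w h) \<le> h * R"
        using e_near by (simp add: R_def algebra_simps)
      then have "\<bar>q (u_old h + s *\<^sub>R d h, e) - q (u (\<tau> h 1), f (u (\<tau> h 1)))\<bar> < c / 4"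
        using elim(4) \<delta>\<^sub>q(1) by (intro q_near[OF T]) (simp add: w_def)
      then have "c / 2 \<le> q (u_old h + s *\<^sub>R d h, e)"
        using q_u by linarith
      then have "c / 2 * h\<^sup>2 \<le> q (u_old h + s *\<^sub>R d h, e) * (H h)\<^sup>2"
        using h H nondegenerate(1) by (intro mult_mono power_mono) auto
      also have "\<dots> = \<eta>2 (u_old h + s *\<^sub>R d h) (d h) (d h)"
        unfolding d_e q_def by (simp add: bounded_bilinear.scaleR_left[OF bil]
            bounded_bilinear.scaleR_right[OF bil] power2_eq_square)
      finally show "c / 2 * h\<^sup>2 \<le> \<eta>2 (u_old h + s *\<^sub>R d h) (d h) (d h)" .
    qed
  qed

  \<comment> \<open>Existence, uniqueness and location of the relaxation parameter\<close>
  define P where "P h \<gamma> \<longleftrightarrow> \<gamma> > 0 \<and>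
    \<eta> (u_old h + \<gamma> *\<^sub>R (u_new h - u_old h)) = \<eta>_old h + \<gamma> * (\<eta>_new h - \<eta>_old h)" for h \<gamma>
  \<comment> \<open>This is 2\<epsilon>/\<mu> for \<epsilon> =
    \<open>C\<^sub>\<eta> * h ^ (p + 1)\<close> and \<mu> = \<open>c / 2 * h\<^sup>2\<close>,
    without its factor \<open>h ^ (p - 1)\<close>.\<close>
  define D where "D = 4 * C\<^sub>\<eta> / c"
  have "D > 0" unfolding D_def using C\<^sub>\<eta> nondegenerate(1) by simp
  have roots: "\<forall>\<^sub>F h in at_right 0. (\<exists>!\<gamma>. P h \<gamma>) \<and> (\<forall>\<gamma>. P h \<gamma> \<longrightarrow> \<bar>\<gamma> - 1\<bar> \<le> D * h ^ (p - 1))"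
    using increments curvature \<eta>_new_bound
      eventually_at_right_0_mult_less[of "c / 2" "8 * C\<^sub>\<eta>", OF half_gt_zero[OF nondegenerate(1)]]
  proof eventually_elim
    case (elim h)
    then have h: "0 < h" "h \<le> 1" by auto
    define r where "r s = \<eta> (u_old h + s *\<^sub>R d h) - (\<eta>_old h + s * (\<eta>_new h - \<eta>_old h))" for s
    define \<mu> where "\<mu> = c / 2 * h\<^sup>2"
    define \<epsilon> where "\<epsilon> = C\<^sub>\<eta> * h ^ (p + 1)"
    have P_iff: "P h \<gamma> \<longleftrightarrow> \<gamma> > 0 \<and> r \<gamma> = 0" for \<gamma>
      by (simp add: P_def r_def d_def)
    have hp: "h ^ (p + 1) = h ^ (p - 1) * h\<^sup>2"
      using order(1) by (simp flip: power_add)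
    have conv: "convex_on UNIV r"
      unfolding r_def[abs_def] by (rule convex_along_line[OF convex])
    have sconv: "convex_on {0..2} (\<lambda>s. r s - \<mu> / 2 * s\<^sup>2)"
      unfolding r_def \<mu>_def
      by (rule strongly_convex_along_line[OF \<eta>1[OF UNIV_I] \<eta>2[OF UNIV_I] bspec[OF elim(2)]])
    have \<mu>: "\<mu> > 0" unfolding \<mu>_def using nondegenerate(1) h by simp
    have r0: "r 0 \<le> 0"
      using convex_old_average[OF convex weights] by (simp add: r_def u_old \<eta>_old)
    have r1: "\<bar>r 1\<bar> \<le> \<epsilon>"
      using elim(3) h by (simp add: r_def d_def \<epsilon>_def abs_minus_commute)
    \<comment> \<open>Order p \<ge> 2 enters here: the residual at 1 is then at least one power of h
      smaller than the curvature.\<close>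
    have "h ^ (p - 1) \<le> h ^ 1"
      using order(1) h by (intro power_decreasing) auto
    then have "8 * C\<^sub>\<eta> * h ^ (p - 1) \<le> 8 * C\<^sub>\<eta> * h"
      using C\<^sub>\<eta> by (intro mult_left_mono) auto
    also have "\<dots> < c / 2"
      using elim(4) by (simp add: mult_ac)
    finally have "8 * C\<^sub>\<eta> * h ^ (p - 1) * h\<^sup>2 < c / 2 * h\<^sup>2"
      using h by (intro mult_strict_right_mono) auto
    then have small: "8 * \<epsilon> < \<mu>"
      unfolding \<epsilon>_def \<mu>_def hp by (simp add: mult_ac)
    have \<epsilon>\<mu>: "2 * \<epsilon> / \<mu> = D * h ^ (p - 1)"
      unfolding \<epsilon>_def \<mu>_def hp D_def using h nondegenerate(1) by simp
    show ?case
      unfolding P_iff \<epsilon>\<mu>[symmetric]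
      using strongly_convex_root[OF conv sconv \<mu> r0 r1 small] by blast
  qed

  \<comment> \<open>Accuracy at the relaxed time\<close>
  have accuracy: "\<forall>\<^sub>F h in at_right 0. \<forall>\<gamma>. P h \<gamma> \<longrightarrow>
      t_old h + \<gamma> * (t_new h - t_old h) \<in> I \<and>
      norm (u_old h + \<gamma> *\<^sub>R (u_new h - u_old h) - u (t_old h + \<gamma> * (t_new h - t_old h)))
        \<le> (C\<^sub>u + D * M + L * (2 + A) * D * (1 + A)) * h ^ (p + 1)"
    using increments roots eventually_at_right_0_mult_less[OF zero_less_one, of "D * (1 + A)"]
  proof eventually_elim
    case (elim h)
    then have h: "0 < h" "h \<le> 1" and T: "\<tau> h 1 \<in> K" and \<delta>h: "(2 + A) * h \<le> \<delta>"
      and H: "h \<le> H h" "H h \<le> (1 + A) * h"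
      and dH: "norm (d h - H h *\<^sub>R w h) \<le> M * h\<^sup>2"
      and new: "norm (u_new h - u (t_new h)) \<le> C\<^sub>u * h ^ (p + 1)"
      by auto
    have hp: "h ^ (p + 1) = h ^ (p - 1) * h\<^sup>2"
      using order(1) by (simp flip: power_add)
    show ?case
    proof (intro allI impI)
      fix \<gamma> assume "P h \<gamma>"
      define \<kappa> where "\<kappa> = \<gamma> - 1"
      have \<kappa>: "\<bar>\<kappa>\<bar> \<le> D * h ^ (p - 1)"
        using elim(2) \<open>P h \<gamma>\<close> by (auto simp: \<kappa>_def)
      define t where "t = t_old h + \<gamma> * (t_new h - t_old h)"
      have t: "t - t_new h = \<kappa> * H h"
        by (simp add: t_def \<kappa>_def H_def algebra_simps)
      have t_diff: "\<bar>t - t_new h\<bar> \<le> (D * h ^ (p - 1)) * ((1 + A) * h)"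
        unfolding t abs_mult using \<kappa> H h \<open>D > 0\<close> by (intro mult_mono) auto
      \<comment> \<open>Again by p \<ge> 2, the relaxed time differs from \<open>t_new\<close> by at
        most h, so it stays in the ball where the linearization holds.\<close>
      have "h ^ (p - 1) \<le> h ^ 1"
        using order(1) h by (intro power_decreasing) auto
      then have "(D * h ^ (p - 1)) * ((1 + A) * h) \<le> (D * h) * ((1 + A) * h)"
        using A \<open>D > 0\<close> h by (intro mult_right_mono mult_left_mono) auto
      also have "\<dots> = (h * (D * (1 + A))) * h" by simp
      also have "\<dots> \<le> 1 * h"
        using elim(3) h by (intro mult_right_mono) auto
      finally have "\<bar>t - t_new h\<bar> \<le> h" using t_diff by simp
      then have t_near: "\<bar>t - \<tau> h 1\<bar> \<le> (2 + A) * h" "\<bar>t_new h - \<tau> h 1\<bar> \<le> (2 + A) * h"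
        using h mult_nonneg_nonneg[of A h] A unfolding t_new distrib_right by linarith+
      have "t \<in> cball (\<tau> h 1) \<delta>"
        using t_near(1) \<delta>h by (simp add: dist_real_def abs_minus_commute)
      then have "t \<in> I" using in_I[OF T] by blast
      have "u_old h + \<gamma> *\<^sub>R (u_new h - u_old h) - u t = (u_new h - u (t_new h))
          + \<kappa> *\<^sub>R (d h - H h *\<^sub>R w h) - (u t - u (t_new h) - (t - t_new h) *\<^sub>R w h)"
        unfolding t by (simp add: d_def \<kappa>_def scaleR_left_diff_distrib scaleR_right_diff_distrib)
      then have "norm (u_old h + \<gamma> *\<^sub>R (u_new h - u_old h) - u t) \<le> norm (u_new h - u (t_new h))
          + norm (\<kappa> *\<^sub>R (d h - H h *\<^sub>R w h)) + norm (u t - u (t_new h) - (t - t_new h) *\<^sub>R w h)"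
        by (simp only: norm_add_diff_le)
      moreover have "norm (\<kappa> *\<^sub>R (d h - H h *\<^sub>R w h)) \<le> (D * h ^ (p - 1)) * (M * h\<^sup>2)"
        unfolding norm_scaleR using \<kappa> dH \<open>D > 0\<close> h by (intro mult_mono) auto
      moreover have "norm (u t - u (t_new h) - (t - t_new h) *\<^sub>R w h)
          \<le> (L * ((2 + A) * h)) * ((D * h ^ (p - 1)) * ((1 + A) * h))"
      proof -
        have "norm (u t - u (t_new h) - (t - t_new h) *\<^sub>R w h) \<le> (L * ((2 + A) * h)) * \<bar>t - t_new h\<bar>"
          unfolding w_def by (rule lin[OF T \<delta>h t_near(2,1)])
        also have "\<dots> \<le> (L * ((2 + A) * h)) * ((D * h ^ (p - 1)) * ((1 + A) * h))"
          using t_diff L A h by (intro mult_left_mono) auto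
        finally show ?thesis .
      qed
      ultimately have "norm (u_old h + \<gamma> *\<^sub>R (u_new h - u_old h) - u t) \<le> C\<^sub>u * h ^ (p + 1)
          + (D * h ^ (p - 1)) * (M * h\<^sup>2) + (L * ((2 + A) * h)) * ((D * h ^ (p - 1)) * ((1 + A) * h))"
        using new by linarith
      also have "\<dots> = (C\<^sub>u + D * M + L * (2 + A) * D * (1 + A)) * h ^ (p + 1)"
        unfolding hp by (simp add: algebra_simps power2_eq_square)
      finally have "norm (u_old h + \<gamma> *\<^sub>R (u_new h - u_old h) - u t)
          \<le> (C\<^sub>u + D * M + L * (2 + A) * D * (1 + A)) * h ^ (p + 1)" .
      with \<open>t \<in> I\<close> show "t_old h + \<gamma> * (t_new h - t_old h) \<in> I \<and>
          norm (u_old h + \<gamma> *\<^sub>R (u_new h - u_old h) - u (t_old h + \<gamma> * (t_new h - t_old h)))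
            \<le> (C\<^sub>u + D * M + L * (2 + A) * D * (1 + A)) * h ^ (p + 1)"
        unfolding t_def by blast
    qed
  qed

  \<comment> \<open>Transfer to an arbitrary choice of relaxation parameters\<close>
  show ?thesis
    unfolding P_def[symmetric]
  proof (intro conjI allI impI)
    show "\<forall>\<^sub>F h in at_right 0. \<exists>!\<gamma>. P h \<gamma>"
      using roots by (rule eventually_mono) blast
    fix \<gamma> assume \<gamma>: "\<forall>\<^sub>F h in at_right 0. P h (\<gamma> h)"
    show "\<forall>\<^sub>F h in at_right 0. t_old h + \<gamma> h * (t_new h - t_old h) \<in> I"
      using \<gamma> accuracy by eventually_elim blast
    show "(\<lambda>h. norm (u_old h + \<gamma> h *\<^sub>R (u_new h - u_old h)
        - u (t_old h + \<gamma> h * (t_new h - t_old h)))) \<in> O[at_right 0](\<lambda>h. h ^ (p + 1))"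
    proof (rule bigoI)
      show "\<forall>\<^sub>F h in at_right 0. norm (norm (u_old h + \<gamma> h *\<^sub>R (u_new h - u_old h)
          - u (t_old h + \<gamma> h * (t_new h - t_old h))))
          \<le> (C\<^sub>u + D * M + L * (2 + A) * D * (1 + A)) * norm (h ^ (p + 1))"
        using \<gamma> accuracy h_pos by eventually_elim simp
    qed
  qed
qed

end
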